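(* Let $A=[a_{i,j}]$ be an $m\times n$ integer matrix and $b\in\mathbb{Z}^m$, and let $A'$ be the $m\times(n+1)$ integer matrix with $a'_{i,j}=a_{i,j}$ for $1\le j\le n$ and $a'_{i,n+1}=-\sum_{j=1}^n a_{i,j}$. Consider the system $$A'\mathbf{x}'\ge b,\qquad \mathbf{x}'\ge 0$$ in the $n+1$ integer variables $\mathbf{x}'=[x_1',\dots,x_n',x_0]^T$. Suppose that $m-k$ of the rows of $A'$ are difference constraints, with $k\le n+1$, and that each of the remaining $k$ rows of $A'$ has at most $w$ nonzero entries, where $w\ge1$ is an integer. Let $a_{\max}$ be the maximum absolute value of the entries of $A'$, $b_{\max}=\max_i|b_i|$, and $s=\min(n+1,m)$. Then $$(n+2)\cdot s\cdot b_{\max}\cdot(a_{\max}\,w)^k$$ is a solution bound for this system.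
   Context: A row of $A'$ is a difference constraint if it has exactly one entry $+1$, exactly one entry $-1$, and all other entries $0$. A solution bound for a system of linear constraints in integer variables is an integer $d$ such that the system has an integer solution if and only if it has an integer solution in which every variable lies in $[0,d]$. The convention $0^0=1$ is used. *)

theory Defs
  imports "Jordan_Normal_Form.Matrix"
begin

text \<open>The matrix \<open>A\<close> extended by a last column holding the negated row sums.
  Indices start at 0, so the additional variable \<open>x\<^sub>0\<close> is component \<open>dim_col A\<close>.\<close>

definition ext_mat :: "int mat \<Rightarrow> int mat" where
  "ext_mat A = mat (dim_row A) (dim_col A + 1)
     (\<lambda>(i, j). if j < dim_col A then A $$ (i, j) else - (\<Sum>l<dim_col A. A $$ (i, l)))"

definition difference_constraint :: "int vec \<Rightarrow> bool" where
  "difference_constraint r \<longleftrightarrow>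
     (\<exists>p<dim_vec r. \<exists>q<dim_vec r. p \<noteq> q \<and> r $ p = 1 \<and> r $ q = - 1 \<and>
        (\<forall>j<dim_vec r. j \<noteq> p \<and> j \<noteq> q \<longrightarrow> r $ j = 0))"

definition num_nonzero :: "int vec \<Rightarrow> nat" where
  "num_nonzero r = card {j. j < dim_vec r \<and> r $ j \<noteq> 0}"

definition nonneg_solutions :: "int mat \<Rightarrow> int vec \<Rightarrow> int vec set" where
  "nonneg_solutions M c =
     {x \<in> carrier_vec (dim_col M). c \<le> M *\<^sub>v x \<and> 0\<^sub>v (dim_col M) \<le> x}"

text \<open>A system of constraints is represented by the set \<open>S\<close> of its integer solutions.\<close>

definition solution_bound :: "int vec set \<Rightarrow> int \<Rightarrow> bool" where
  "solution_bound S d \<longleftrightarrow>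
     ((\<exists>x. x \<in> S) \<longleftrightarrow> (\<exists>x. x \<in> S \<and> (\<forall>j<dim_vec x. x $ j \<in> {0..d})))"

text \<open>Both maxima are unspecified if there are no entries. With \<open>m\<close> rows and \<open>n + 1\<close>
  columns this means \<open>m = 0\<close>, where the factor \<open>min (n + 1) m\<close> of the bound is 0.\<close>

definition max_abs_mat :: "int mat \<Rightarrow> int" where
  "max_abs_mat M = Max (abs ` elements_mat M)"

definition max_abs_vec :: "int vec \<Rightarrow> int" where
  "max_abs_vec v = Max (abs ` set\<^sub>v v)"

end

theory Submission
  imports Defs "Jordan_Normal_Form.Determinant"
begin

text \<open>Homogenise \<open>A' x \<ge> b\<close>, \<open>x \<ge> 0\<close> with a further variable \<open>t \<ge> 0\<close>. The result is a pointed
  cone in dimension \<open>n + 2\<close>, so an integer solution \<open>(z, 1)\<close> is a nonnegative combination of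
  linearly independent, hence at most \<open>n + 2\<close>, extreme rays. By Cramer's rule the rays can be taken
  integral with entries bounded by the minors of order \<open>n + 1\<close> of the constraint matrix.
  Subtracting the integer parts of the coefficients of the rays with \<open>t = 0\<close> from \<open>z\<close> leaves an
  integer solution whose coefficients on these rays, of which there are at most \<open>n + 1\<close>, are
  below 1 and whose other coefficients sum up to at most 1; so its entries are at most \<open>n + 2\<close> times
  the bound on the minors. Expanding a minor along the column of \<open>b\<close> gives the factor
  \<open>s \<cdot> b\<^sub>m\<^sub>a\<^sub>x\<close>, and each of the \<open>k\<close> sparse rows gives a factor \<open>a\<^sub>m\<^sub>a\<^sub>x w\<close>; without sparse rows a minor
  is at most 1 because difference constraints are totally unimodular.\<close>

subsection \<open>Extreme rays of pointed cones\<close>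

lemma trivial_kernel_imp_det_nonzero:
  fixes a :: "nat \<Rightarrow> nat \<Rightarrow> 'a::field"
  assumes "\<And>v. (\<And>i. i < d \<Longrightarrow> (\<Sum>j<d. a i j * v j) = 0) \<Longrightarrow> \<forall>j<d. v j = 0"
  shows "det (mat d d (\<lambda>(i,j). a i j)) \<noteq> 0"
proof
  let ?A = "mat d d (\<lambda>(i,j). a i j)"
  assume "det ?A = 0"
  then obtain v where v: "v \<in> carrier_vec d" "v \<noteq> 0\<^sub>v d" "?A *\<^sub>v v = 0\<^sub>v d"
    using det_0_iff_vec_prod_zero_field[of ?A d] by auto
  have "(\<Sum>j<d. a i j * v $ j) = 0" if "i < d" for i
  proof -
    have "(\<Sum>j<d. a i j * v $ j) = (?A *\<^sub>v v) $ i"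
      using v(1) that by (simp add: scalar_prod_def lessThan_atLeast0)
    then show ?thesis using v(3) that by simp
  qed
  then have "\<forall>j<d. v $ j = 0" using assms[of "\<lambda>j. v $ j"] by blast
  then show False using v(1,2) by auto
qed

text \<open>Padding the system with zero rows makes it square. Because \<open>card R < d\<close>,
  row \<open>d - 1\<close> is a padding row, so the determinant vanishes and the kernel cannot be
  trivial.\<close>

lemma underdetermined_system_nonzero_solution:
  fixes a :: "'i \<Rightarrow> nat \<Rightarrow> 'a::field"
  assumes "finite R" "card R < d"
  shows "\<exists>v. (\<exists>j<d. v j \<noteq> 0) \<and> (\<forall>i\<in>R. (\<Sum>j<d. a i j * v j) = 0)"
proof (rule ccontr)
  assume no: "\<not> ?thesis"
  obtain h where h: "bij_betw h {0..<card R} R"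
    using assms(1) ex_bij_betw_nat_finite by blast
  let ?a = "\<lambda>i j. if i < card R then a (h i) j else 0"
  have "det (mat d d (\<lambda>(i,j). ?a i j)) \<noteq> 0"
  proof (rule trivial_kernel_imp_det_nonzero)
    fix v assume v: "\<And>i. i < d \<Longrightarrow> (\<Sum>j<d. ?a i j * v j) = 0"
    have "(\<Sum>j<d. a i j * v j) = 0" if "i \<in> R" for i
    proof -
      have "i \<in> h ` {0..<card R}" using bij_betw_imp_surj_on[OF h] that by blast
      then obtain l where "l < card R" "i = h l" by auto
      then show ?thesis using v[of l] assms(2) by simp
    qed
    then show "\<forall>j<d. v j = 0" using no by blast
  qed
  moreover have "det (mat d d (\<lambda>(i,j). ?a i j)) = 0"
  proof -
    have "(\<Sum>j<d. mat d d (\<lambda>(i,j). ?a i j) $$ (d-1,j) *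
        cofactor (mat d d (\<lambda>(i,j). ?a i j)) (d-1) j) = 0"
      using assms(2) by (intro sum.neutral) auto
    then show ?thesis
      using laplace_expansion_row[of "mat d d (\<lambda>(i,j). ?a i j)" d "d-1"] assms(2) by auto
  qed
  ultimately show False by blast
qed

text \<open>The coefficients of a vanishing combination solve \<open>d\<close> equations in
  \<open>card R\<close> unknowns, so with more than \<open>d\<close> vectors the previous lemma
  yields a nontrivial one. Indexing by \<open>R\<close> rather than by the vectors themselves lets
  repetitions count.\<close>

lemma card_le_dim_of_independent:
  fixes f :: "'i \<Rightarrow> nat \<Rightarrow> 'a::field"
  assumes "finite R"
    and "\<And>\<alpha>. (\<And>j. j < d \<Longrightarrow> (\<Sum>i\<in>R. \<alpha> i * f i j) = 0) \<Longrightarrow> \<forall>i\<in>R. \<alpha> i = 0"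
  shows "card R \<le> d"
proof (rule ccontr)
  assume "\<not> card R \<le> d"
  obtain h where h: "bij_betw h {0..<card R} R"
    using assms(1) ex_bij_betw_nat_finite by blast
  obtain v where v: "\<exists>l<card R. v l \<noteq> 0" "\<And>j. j < d \<Longrightarrow> (\<Sum>l<card R. f (h l) j * v l) = 0"
    using underdetermined_system_nonzero_solution[of "{..<d}" "card R" "\<lambda>j l. f (h l) j"]
      \<open>\<not> card R \<le> d\<close> by auto
  define \<alpha> where "\<alpha> i = v (the_inv_into {0..<card R} h i)" for i
  have \<alpha>: "\<alpha> (h l) = v l" if "l < card R" for l
    unfolding \<alpha>_def by (rule arg_cong[of _ _ v], rule the_inv_into_f_f)
      (use bij_betw_imp_inj_on[OF h] that in auto)
  have "(\<Sum>i\<in>R. \<alpha> i * f i j) = 0" if "j < d" for j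
  proof -
    have "(\<Sum>i\<in>R. \<alpha> i * f i j) = (\<Sum>l\<in>{0..<card R}. \<alpha> (h l) * f (h l) j)"
      using sum.reindex_bij_betw[OF h, of "\<lambda>i. \<alpha> i * f i j"] by simp
    also have "\<dots> = (\<Sum>l<card R. f (h l) j * v l)"
      by (intro sum.cong) (auto simp: \<alpha> mult.commute)
    finally show ?thesis using v(2) that by simp
  qed
  then have "\<forall>i\<in>R. \<alpha> i = 0" using assms(2) by blast
  moreover obtain l where "l < card R" "v l \<noteq> 0" using v(1) by blast
  moreover have "h l \<in> R" using bij_betw_apply[OF h] \<open>l < card R\<close> by simp
  ultimately show False using \<alpha> by force
qed

section \<open>Polyhedral cones given by integral rows, and their decomposition into extreme
  rays\<close>

locale pointed_cone =
  fixes d :: nat and I :: "'i set" and G :: "'i \<Rightarrow> nat \<Rightarrow> int"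
  assumes finite_I: "finite I"
    and pointed: "\<And>v. (\<And>i. i \<in> I \<Longrightarrow> (\<Sum>j<d. real_of_int (G i j) * v j) = 0)
      \<Longrightarrow> \<forall>j<d. v j = 0"
begin

definition ev :: "'i \<Rightarrow> (nat \<Rightarrow> real) \<Rightarrow> real" where
  "ev i v = (\<Sum>j<d. real_of_int (G i j) * v j)"

definition cone :: "(nat \<Rightarrow> real) set" where
  "cone = {u. \<forall>i\<in>I. 0 \<le> ev i u}"

definition tight :: "(nat \<Rightarrow> real) \<Rightarrow> 'i set" where
  "tight u = {i\<in>I. ev i u = 0}"

text \<open>Extreme rays in algebraic form, through the solution space of the tight rows. As the
  cone is pointed, \<open>tight r \<noteq> I\<close> says exactly that \<open>r\<close> is nonzero
  on the first \<open>d\<close> coordinates.\<close>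

definition extremal :: "(nat \<Rightarrow> real) \<Rightarrow> bool" where
  "extremal r \<longleftrightarrow> r \<in> cone \<and> tight r \<noteq> I \<and>
    (\<forall>v. (\<forall>i\<in>tight r. ev i v = 0) \<longrightarrow> (\<exists>\<alpha>. \<forall>j<d. v j = \<alpha> * r j))"

lemma ev_linear: "ev i (\<lambda>j. u j + c * v j) = ev i u + c * ev i v"
  unfolding ev_def by (simp add: algebra_simps sum.distrib sum_distrib_left)

lemma ev_uminus: "ev i (\<lambda>j. - v j) = - ev i v"
  unfolding ev_def by (simp add: sum_negf)

lemma ev_scale: "ev i (\<lambda>j. c * v j) = c * ev i v"
  unfolding ev_def by (simp add: algebra_simps sum_distrib_left)

lemma ev_sum: "ev i (\<lambda>j. \<Sum>l\<in>L. \<beta> l * f l j) = (\<Sum>l\<in>L. \<beta> l * ev i (f l))"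
  unfolding ev_def
  by (simp add: sum_distrib_left sum.swap[of _ "{..<d}"] algebra_simps)

lemma ev_cong: "(\<And>j. j < d \<Longrightarrow> u j = v j) \<Longrightarrow> ev i u = ev i v"
  unfolding ev_def by (intro sum.cong) auto

lemma ev_zero: "(\<And>j. j < d \<Longrightarrow> u j = 0) \<Longrightarrow> ev i u = 0"
  unfolding ev_def by (intro sum.neutral) auto

lemma pointed_ev: "(\<And>i. i \<in> I \<Longrightarrow> ev i v = 0) \<Longrightarrow> j < d \<Longrightarrow> v j = 0"
  using pointed unfolding ev_def by blast

lemma finite_tight: "finite (tight u)"
  using finite_I by (simp add: tight_def)

text \<open>The ratio test: among the rows that decrease along \<open>v\<close>, the one with the
  smallest quotient of \<open>ev i u\<close> and \<open>- ev i v\<close> is the first to reach 0,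
  and at that moment no other row has become negative.\<close>

lemma move_to_boundary:
  assumes "u \<in> cone" and "i0 \<in> I" "ev i0 v < 0"
  obtains c i where "0 \<le> c" "(\<lambda>j. u j + c * v j) \<in> cone" "i \<in> I" "ev i v < 0"
    "ev i u + c * ev i v = 0"
proof -
  define N where "N = {i\<in>I. ev i v < 0}"
  have N: "finite N" "N \<noteq> {}" using finite_I assms by (auto simp: N_def)
  define q where "q i = ev i u / (- ev i v)" for i
  obtain i where i: "i \<in> N" "\<And>l. l \<in> N \<Longrightarrow> q i \<le> q l"
    using arg_min_if_finite[OF N, of q] by (meson not_le)
  have q0: "0 \<le> q i" using i(1) assms(1) by (auto simp: q_def N_def cone_def divide_nonneg_neg)
  show ?thesis
  proof (rule that[of "q i" i])
    show "(\<lambda>j. u j + q i * v j) \<in> cone"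
      unfolding cone_def mem_Collect_eq ev_linear
    proof
      fix l assume l: "l \<in> I"
      show "0 \<le> ev l u + q i * ev l v"
      proof (cases "ev l v < 0")
        case True
        then have "q i \<le> ev l u / (- ev l v)" using i(2)[of l] l by (simp add: N_def q_def)
        then have "q i * (- ev l v) \<le> ev l u" using True
          by (metis neg_0_less_iff_less pos_le_divide_eq)
        then show ?thesis by simp
      next
        case False
        then show ?thesis using q0 l assms(1) by (auto simp: cone_def)
      qed
    qed
  qed (use i q0 in \<open>auto simp: N_def q_def\<close>)
qed

text \<open>If \<open>u\<close> is not extremal, some direction preserves its tight rows without
  being a multiple of \<open>u\<close>. Moving along it up to the boundary makes a further row
  tight, so the number of rows that are not tight is a termination measure.\<close>

lemma ex_extremal:
  assumes "u \<in> cone" "tight u \<noteq> I"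
  shows "\<exists>r. extremal r \<and> tight u \<subseteq> tight r"
  using assms
proof (induction "card (I - tight u)" arbitrary: u rule: less_induct)
  case less
  show ?case
  proof (cases "extremal u")
    case False
    then obtain v where v: "\<forall>i\<in>tight u. ev i v = 0" "\<not> (\<exists>\<alpha>. \<forall>j<d. v j = \<alpha> * u j)"
      using less.prems by (auto simp: extremal_def)
    have "\<exists>i\<in>I. ev i v \<noteq> 0"
    proof (rule ccontr)
      assume "\<not> ?thesis"
      then have "\<forall>j<d. v j = 0 * u j" using pointed_ev[of v] by auto
      then show False using v(2) by blast
    qed
    then obtain i0 where i0: "i0 \<in> I" "ev i0 v \<noteq> 0" by blast
    \<comment> \<open>The sign is chosen so that at least one row decreases along \<open>v'\<close>,
      which is what the ratio test needs.\<close>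
    define \<sigma> :: real where "\<sigma> = (if ev i0 v < 0 then 1 else - 1)"
    define v' where "v' = (\<lambda>j. \<sigma> * v j)"
    have \<sigma>: "\<sigma> * \<sigma> = 1" by (simp add: \<sigma>_def)
    have v': "i0 \<in> I" "ev i0 v' < 0" "\<forall>i\<in>tight u. ev i v' = 0"
      using i0 v(1) by (auto simp: v'_def ev_scale \<sigma>_def)
    have nv': "\<not> (\<exists>\<alpha>. \<forall>j<d. v' j = \<alpha> * u j)"
    proof
      assume "\<exists>\<alpha>. \<forall>j<d. v' j = \<alpha> * u j"
      then obtain \<alpha> where \<alpha>: "\<forall>j<d. v' j = \<alpha> * u j" by blast
      have "v j = \<sigma> * \<alpha> * u j" if "j < d" for j
      proof -
        have "v j = \<sigma> * v' j" using \<sigma> by (simp add: v'_def flip: mult.assoc)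
        then show ?thesis using \<alpha> that by simp
      qed
      then show False using v(2) by blast
    qed
    obtain c i where c: "0 \<le> c" "(\<lambda>j. u j + c * v' j) \<in> cone" "i \<in> I" "ev i v' < 0"
      "ev i u + c * ev i v' = 0"
      using move_to_boundary[OF less.prems(1) v'(1,2)] .
    let ?u = "\<lambda>j. u j + c * v' j"
    have sub: "tight u \<subseteq> tight ?u" using v'(3) by (auto simp: tight_def ev_linear)
    have "i \<in> tight ?u" "i \<notin> tight u"
      using c v'(3) by (auto simp: tight_def ev_linear)
    then have "card (I - tight ?u) < card (I - tight u)"
      using sub c(3) finite_I by (intro psubset_card_mono) auto
    \<comment> \<open>The move does not end in the apex: there pointedness would make
      \<open>v'\<close> a multiple of \<open>u\<close>.\<close>
    moreover have "tight ?u \<noteq> I"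
    proof
      assume t: "tight ?u = I"
      have z: "u j + c * v' j = 0" if "j < d" for j
        using pointed_ev[of ?u j] t that by (auto simp: tight_def)
      have "c \<noteq> 0"
      proof
        assume "c = 0"
        then show False using t less.prems(2) by simp
      qed
      then have "v' j = (- 1 / c) * u j" if "j < d" for j
        using z[OF that] by (simp add: field_simps)
      then show False using nv' by blast
    qed
    ultimately show ?thesis using less.hyps c(2) sub by blast
  qed (use less.prems in blast)
qed

text \<open>Subtract the largest possible multiple of an extreme ray \<open>r\<close> whose tight
  rows include those of \<open>u\<close>. This makes a new row \<open>i\<close> tight with
  \<open>ev i r \<noteq> 0\<close>, while all rays found for the remainder vanish on row
  \<open>i\<close>. Independence is therefore triangular and comes along with the induction.\<close>

lemma extremal_decomposition:
  assumes "u \<in> cone"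
  shows "\<exists>(p::nat) r \<beta>. (\<forall>l<p. extremal (r l) \<and> tight u \<subseteq> tight (r l) \<and> 0 \<le> \<beta> l) \<and>
    (\<forall>j<d. u j = (\<Sum>l<p. \<beta> l * r l j)) \<and>
    (\<forall>\<alpha>. (\<forall>j<d. (\<Sum>l<p. \<alpha> l * r l j) = 0) \<longrightarrow> (\<forall>l<p. \<alpha> l = 0))"
    (is "\<exists>p r \<beta>. ?P u p r \<beta>")
  using assms
proof (induction "card (I - tight u)" arbitrary: u rule: less_induct)
  case less
  show ?case
  proof (cases "tight u = I")
    case True
    then have "\<forall>j<d. u j = 0" using pointed_ev[of u] by (auto simp: tight_def)
    then show ?thesis by (intro exI[of _ 0]) simp
  next
    case False
    then obtain r where r: "extremal r" "tight u \<subseteq> tight r"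
      using ex_extremal less.prems by blast
    then obtain i0 where "i0 \<in> I" "0 \<le> ev i0 r" "ev i0 r \<noteq> 0"
      unfolding extremal_def cone_def tight_def by blast
    then have "i0 \<in> I" "ev i0 (\<lambda>j. - r j) < 0" by (simp_all add: ev_uminus)
    then obtain c i where c: "0 \<le> c" "(\<lambda>j. u j + c * - r j) \<in> cone" "i \<in> I"
      "ev i (\<lambda>j. - r j) < 0" "ev i u + c * ev i (\<lambda>j. - r j) = 0"
      by (rule move_to_boundary[OF less.prems])
    let ?u = "\<lambda>j. u j - c * r j"
    have ev_u: "ev l ?u = ev l u - c * ev l r" for l
      using ev_linear[of l u "- c" r] by simp
    have u_cone: "?u \<in> cone" using c(2) by simp
    have sub: "tight u \<subseteq> tight ?u"
      using r(2) by (auto simp: tight_def ev_u)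
    have i: "i \<in> tight ?u" "i \<notin> tight u" "ev i r \<noteq> 0"
      using c r(2) by (auto simp: tight_def ev_u ev_uminus)
    then have "card (I - tight ?u) < card (I - tight u)"
      using sub c(3) finite_I by (intro psubset_card_mono) auto
    from less.hyps[OF this u_cone] obtain p rs \<beta> where IH: "?P ?u p rs \<beta>" by (elim exE)
    let ?r = "rs(p := r)" and ?l = "\<beta>(p := c)"
    have "?P u (Suc p) ?r ?l"
    proof (intro conjI allI impI)
      fix l assume l: "l < Suc p"
      show "extremal (?r l)" "0 \<le> ?l l" using l IH r c by (auto simp: less_Suc_eq)
      show "tight u \<subseteq> tight (?r l)" using l IH sub r by (auto simp: less_Suc_eq)
    next
      fix j assume j: "j < d"
      have "u j - c * r j = (\<Sum>l<p. \<beta> l * rs l j)" using IH j by blast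
      moreover have "(\<Sum>l<Suc p. ?l l * ?r l j) = (\<Sum>l<p. \<beta> l * rs l j) + c * r j" by simp
      ultimately show "u j = (\<Sum>l<Suc p. ?l l * ?r l j)" by simp
    next
      fix \<alpha> l assume \<alpha>: "\<forall>j<d. (\<Sum>l<Suc p. \<alpha> l * ?r l j) = 0" and l: "l < Suc p"
      \<comment> \<open>Row \<open>i\<close> annihilates all rays except the new one, so it isolates
        the coefficient of \<open>r\<close>.\<close>
      have "ev i (\<lambda>j. \<Sum>l<Suc p. \<alpha> l * ?r l j) = 0" by (rule ev_zero) (use \<alpha> in blast)
      then have "(\<Sum>l<p. \<alpha> l * ev i (rs l)) + \<alpha> p * ev i r = 0"
        unfolding ev_sum by simp
      moreover have "ev i (rs l) = 0" if "l < p" for l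
        using IH i(1) that by (auto simp: tight_def)
      ultimately have "\<alpha> p = 0" using i(3) by simp
      moreover from this have "\<forall>j<d. (\<Sum>l<p. \<alpha> l * rs l j) = 0" using \<alpha> by simp
      then have "\<forall>l<p. \<alpha> l = 0" using IH by blast
      ultimately show "\<alpha> l = 0" using l by (auto simp: less_Suc_eq)
    qed
    then show ?thesis by (intro exI)
  qed
qed

end

section \<open>Integral kernel vectors from maximal minors\<close>

text \<open>The generalised cross product of \<open>d - 1\<close> rows in dimension
  \<open>d\<close>. The sign is that of the cofactors of row \<open>d - 1\<close>, the place where a
  further row is appended below.\<close>

definition minor_vec :: "nat \<Rightarrow> (nat \<Rightarrow> nat \<Rightarrow> 'a::comm_ring_1) \<Rightarrow> nat \<Rightarrow> 'a" where
  "minor_vec d a j = (- 1) ^ (d - 1 + j) *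
     det (mat (d - 1) (d - 1) (\<lambda>(i,l). a i (insert_index j l)))"

lemma minor_vec_scalar_product:
  assumes "0 < d"
  shows "(\<Sum>j<d. h j * minor_vec d a j) =
    det (mat d d (\<lambda>(i,j). if i < d - 1 then a i j else h j))"
proof -
  let ?B = "mat d d (\<lambda>(i,j). if i < d - 1 then a i j else h j)"
  have "det ?B = (\<Sum>j<d. ?B $$ (d-1,j) * cofactor ?B (d-1) j)"
    using assms by (intro laplace_expansion_row) auto
  also have "\<dots> = (\<Sum>j<d. h j * minor_vec d a j)"
  proof (rule sum.cong)
    fix j assume "j \<in> {..<d}"
    then have "mat_delete ?B (d-1) j = mat (d - 1) (d - 1) (\<lambda>(i,l). a i (insert_index j l))"
      by (intro eq_matI) (auto simp: mat_delete_def insert_index_def)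
    then show "?B $$ (d-1,j) * cofactor ?B (d-1) j = h j * minor_vec d a j"
      using \<open>j \<in> {..<d}\<close> by (simp add: cofactor_def minor_vec_def)
  qed simp
  finally show ?thesis by simp
qed

text \<open>The scalar product is the determinant of a matrix in which row \<open>i\<close> occurs
  twice.\<close>

lemma minor_vec_in_kernel:
  assumes "i < d - 1"
  shows "(\<Sum>j<d. a i j * minor_vec d a j) = 0"
proof -
  have "det (mat d d (\<lambda>(i',j). if i' < d - 1 then a i' j else a i j)) = 0"
    by (rule det_identical_rows[of _ d i "d-1"]) (use assms in \<open>auto\<close>)
  then show ?thesis using minor_vec_scalar_product[of d "a i" a] assms by simp
qed

lemma minor_vec_of_int:
  "minor_vec d (\<lambda>i j. of_int (a i j) :: 'a::comm_ring_1) j = of_int (minor_vec d a j)"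
proof -
  have "mat (d - 1) (d - 1) (\<lambda>(i,l). of_int (a i (insert_index j l)) :: 'a) =
    map_mat of_int (mat (d - 1) (d - 1) (\<lambda>(i,l). a i (insert_index j l)))"
    by (intro eq_matI) auto
  then show ?thesis by (simp add: minor_vec_def of_int_hom.hom_det)
qed

lemma abs_minor_vec:
  fixes a :: "nat \<Rightarrow> nat \<Rightarrow> int"
  shows "\<bar>minor_vec d a j\<bar> = \<bar>det (mat (d - 1) (d - 1) (\<lambda>(i,l). a i (insert_index j l)))\<bar>"
  by (simp add: minor_vec_def abs_mult power_abs)

context pointed_cone
begin

text \<open>A minimal set of tight rows that still has kernel spanned by \<open>r\<close> has \<open>d - 1\<close> elements.\<close>

lemma extremal_row_basis:
  assumes r: "extremal r"
  shows "\<exists>R\<subseteq>I. card R = d - 1 \<and> (\<forall>i\<in>R. ev i r = 0) \<and>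
    (\<forall>v. (\<forall>i\<in>R. ev i v = 0) \<longrightarrow> (\<exists>\<alpha>. \<forall>j<d. v j = \<alpha> * r j))"
proof -
  define spans where "spans R \<longleftrightarrow>
    (\<forall>v. (\<forall>i\<in>R. ev i v = 0) \<longrightarrow> (\<exists>\<alpha>. \<forall>j<d. v j = \<alpha> * r j))" for R
  define F where "F = {R. R \<subseteq> tight r \<and> spans R}"
  have "tight r \<in> F" using r by (simp add: F_def spans_def extremal_def)
  moreover have "finite F"
    using finite_tight[of r] by (auto simp: F_def intro: finite_subset[of _ "Pow (tight r)"])
  ultimately obtain R where R: "R \<in> F" "\<And>R'. R' \<in> F \<Longrightarrow> R' \<subseteq> R \<Longrightarrow> R = R'"
    using finite_has_minimal[of F] by (metis empty_iff)
  have sub: "R \<subseteq> tight r" and sp: "spans R" using R(1) by (auto simp: F_def)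
  have fR: "finite R" using sub finite_tight finite_subset by blast
  have R0: "ev i r = 0" if "i \<in> R" for i using sub that by (auto simp: tight_def)
  have "\<not> (\<forall>j<d. r j = 0)"
    using r ev_zero[of r] by (auto simp: extremal_def tight_def)
  then obtain j0 where j0: "j0 < d" "r j0 \<noteq> 0" by blast
  \<comment> \<open>Minimality of \<open>R\<close>: without row \<open>i\<close> the kernel grows,
    which yields a vector seen by row \<open>i\<close> alone.\<close>
  have "\<exists>v. ev i v \<noteq> 0 \<and> (\<forall>l\<in>R - {i}. ev l v = 0)" if i: "i \<in> R" for i
  proof (rule ccontr)
    assume no: "\<not> ?thesis"
    have "spans (R - {i})"
      unfolding spans_def
    proof (intro allI impI)
      fix v assume "\<forall>l\<in>R - {i}. ev l v = 0"
      then have "\<forall>l\<in>R. ev l v = 0" using no by blast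
      then show "\<exists>\<alpha>. \<forall>j<d. v j = \<alpha> * r j" using sp by (simp add: spans_def)
    qed
    then have "R - {i} \<in> F" using sub by (auto simp: F_def)
    then show False using R(2)[of "R - {i}"] i by blast
  qed
  then obtain V where V: "\<And>i. i \<in> R \<Longrightarrow> ev i (V i) \<noteq> 0"
      "\<And>i l. i \<in> R \<Longrightarrow> l \<in> R \<Longrightarrow> l \<noteq> i \<Longrightarrow> ev l (V i) = 0"
    by (metis Diff_iff singletonD)
  \<comment> \<open>The vectors \<open>V i\<close> form a dual system to the rows in
    \<open>R\<close>, and \<open>r\<close> (at index \<open>None\<close>) is killed by all of these
    rows. Together they are independent, whence \<open>card R + 1 \<le> d\<close>.\<close>
  define f where "f x = (case x of None \<Rightarrow> r | Some i \<Rightarrow> V i)" for x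
  have "card (insert None (Some ` R)) \<le> d"
  proof (rule card_le_dim_of_independent[of _ _ f])
    fix \<alpha> assume \<alpha>: "\<And>j. j < d \<Longrightarrow> (\<Sum>x\<in>insert None (Some ` R). \<alpha> x * f x j) = 0"
    have zero: "\<alpha> (Some i) = 0" if i: "i \<in> R" for i
    proof -
      have vanish: "ev i (V x) = 0" if "x \<in> R - {i}" for x
        using V(2)[of x i] i that by blast
      have "0 = ev i (\<lambda>j. \<Sum>x\<in>insert None (Some ` R). \<alpha> x * f x j)"
        using ev_zero \<alpha> by simp
      also have "\<dots> = \<alpha> None * ev i r + (\<Sum>x\<in>R. \<alpha> (Some x) * ev i (V x))"
        unfolding ev_sum using fR by (simp add: sum.reindex f_def)
      also have "(\<Sum>x\<in>R. \<alpha> (Some x) * ev i (V x)) = \<alpha> (Some i) * ev i (V i)"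
        by (simp add: sum.remove[OF fR i] vanish)
      finally show ?thesis using R0[OF i] V(1)[OF i] by simp
    qed
    have "\<alpha> None * r j0 + (\<Sum>x\<in>R. \<alpha> (Some x) * V x j0) = 0"
      using \<alpha>[OF j0(1)] fR by (simp add: sum.reindex f_def)
    then have "\<alpha> None = 0" using zero j0 by simp
    then show "\<forall>x\<in>insert None (Some ` R). \<alpha> x = 0" using zero by simp
  qed (use fR in simp)
  then have "Suc (card R) \<le> d" using fR by (simp add: card_image)
  moreover have "d \<le> Suc (card R)"
  proof (rule ccontr)
    assume "\<not> d \<le> Suc (card R)"
    \<comment> \<open>The vector \<open>r\<close> is added as one more equation. A solution of the
      enlarged system is a multiple of \<open>r\<close> and orthogonal to \<open>r\<close>, hence
      zero; so there must be at least \<open>d\<close> equations.\<close>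
    define a where "a x j = (case x of None \<Rightarrow> r j | Some i \<Rightarrow> real_of_int (G i j))" for x j
    obtain v where v: "\<exists>j<d. v j \<noteq> 0" "\<forall>x\<in>insert None (Some ` R). (\<Sum>j<d. a x j * v j) = 0"
      using underdetermined_system_nonzero_solution[of "insert None (Some ` R)" d a]
        \<open>\<not> d \<le> Suc (card R)\<close> fR by (auto simp: card_image)
    have "\<forall>i\<in>R. ev i v = 0" using v(2) by (auto simp: a_def ev_def)
    then obtain \<alpha> where \<alpha>: "\<forall>j<d. v j = \<alpha> * r j" using sp unfolding spans_def by blast
    have "0 = (\<Sum>j<d. r j * v j)" using v(2) by (simp add: a_def)
    also have "\<dots> = \<alpha> * (\<Sum>j<d. (r j)\<^sup>2)"
      unfolding sum_distrib_left by (rule sum.cong) (auto simp: \<alpha> power2_eq_square)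
    finally have "\<alpha> = 0 \<or> (\<Sum>j<d. (r j)\<^sup>2) = 0" by simp
    moreover have "(\<Sum>j<d. (r j)\<^sup>2) > 0"
      using j0 by (intro sum_pos2[of _ j0]) auto
    ultimately show False using v(1) \<alpha> by auto
  qed
  ultimately have "card R = d - 1" by simp
  moreover have "R \<subseteq> I" using sub by (auto simp: tight_def)
  ultimately show ?thesis using R0 sp unfolding spans_def by blast
qed

text \<open>Cramer's rule: the vector of minors of a row basis is integral and lies in the kernel
  line of \<open>r\<close>. It remains to see that it is nonzero and to orient it like
  \<open>r\<close>.\<close>

lemma extremal_integral:
  assumes r: "extremal r"
    and M: "\<And>\<rho> c. inj_on \<rho> {..<d - 1} \<Longrightarrow> \<rho> ` {..<d - 1} \<subseteq> I \<Longrightarrow> c < d \<Longrightarrow>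
      \<bar>det (mat (d - 1) (d - 1) (\<lambda>(i,l). G (\<rho> i) (insert_index c l)))\<bar> \<le> M"
  obtains c \<mu> where "\<mu> > 0" "\<And>j. j < d \<Longrightarrow> r j = \<mu> * real_of_int (c j)"
    "\<And>j. j < d \<Longrightarrow> \<bar>c j\<bar> \<le> M"
proof -
  obtain R where R: "R \<subseteq> I" "card R = d - 1" "\<forall>i\<in>R. ev i r = 0"
    "\<forall>v. (\<forall>i\<in>R. ev i v = 0) \<longrightarrow> (\<exists>\<alpha>. \<forall>j<d. v j = \<alpha> * r j)"
    using extremal_row_basis[OF r] by blast
  have "finite R" using R(1) finite_I finite_subset by blast
  then obtain \<rho> where \<rho>: "bij_betw \<rho> {0..<d - 1} R"
    using ex_bij_betw_nat_finite R(2) by metis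
  have "\<not> (\<forall>j<d. r j = 0)"
    using r ev_zero[of r] by (auto simp: extremal_def tight_def)
  then obtain j0 where j0: "j0 < d" "r j0 \<noteq> 0" by blast
  have \<rho>_surj: "\<exists>l<d - 1. i = \<rho> l" if "i \<in> R" for i
  proof -
    have "i \<in> \<rho> ` {0..<d - 1}" using bij_betw_imp_surj_on[OF \<rho>] that by blast
    then show ?thesis by auto
  qed
  define c where "c = minor_vec d (\<lambda>l. G (\<rho> l))"
  define a where "a l j = real_of_int (G (\<rho> l) j)" for l j
  have c_real: "minor_vec d a j = real_of_int (c j)" for j
    unfolding a_def c_def by (rule minor_vec_of_int)
  have "ev i (\<lambda>j. real_of_int (c j)) = 0" if "i \<in> R" for i
    using \<rho>_surj[OF that] minor_vec_in_kernel[of _ d a] by (auto simp: ev_def c_real a_def)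
  then obtain \<alpha> where \<alpha>: "\<forall>j<d. real_of_int (c j) = \<alpha> * r j" using R(4) by blast
  \<comment> \<open>Appending \<open>r\<close> as last row gives a regular matrix, since a kernel
    vector would be a multiple of \<open>r\<close> orthogonal to \<open>r\<close>. Its determinant
    is the scalar product of \<open>r\<close> with the minors, so these do not all vanish.\<close>
  have "det (mat d d (\<lambda>(i,j). if i < d - 1 then a i j else r j)) \<noteq> 0"
  proof (rule trivial_kernel_imp_det_nonzero)
    fix v assume v: "\<And>i. i < d \<Longrightarrow> (\<Sum>j<d. (if i < d - 1 then a i j else r j) * v j) = 0"
    have "ev i v = 0" if "i \<in> R" for i
    proof -
      obtain l where l: "l < d - 1" "i = \<rho> l" using \<rho>_surj[OF \<open>i \<in> R\<close>] by blast
      then show ?thesis using v[of l] by (simp add: ev_def a_def)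
    qed
    then obtain \<beta> where \<beta>: "\<forall>j<d. v j = \<beta> * r j" using R(4) by blast
    have "0 = (\<Sum>j<d. r j * v j)" using v[of "d - 1"] j0 by simp
    also have "\<dots> = \<beta> * (\<Sum>j<d. (r j)\<^sup>2)"
      unfolding sum_distrib_left by (rule sum.cong) (auto simp: \<beta> power2_eq_square)
    finally have "\<beta> = 0 \<or> (\<Sum>j<d. (r j)\<^sup>2) = 0" by simp
    moreover have "(\<Sum>j<d. (r j)\<^sup>2) > 0"
      using j0 by (intro sum_pos2[of _ j0]) auto
    ultimately show "\<forall>j<d. v j = 0" using \<beta> by auto
  qed
  then have "(\<Sum>j<d. r j * real_of_int (c j)) \<noteq> 0"
    using minor_vec_scalar_product[of d r a] j0 by (simp add: c_real)
  then have "\<alpha> \<noteq> 0" using \<alpha> by auto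
  have cM: "\<bar>c j\<bar> \<le> M" if "j < d" for j
    using M[of \<rho> j] \<rho> R(1) that
    by (simp add: c_def abs_minor_vec bij_betw_def lessThan_atLeast0)
  \<comment> \<open>The factor relating \<open>r\<close> and \<open>c\<close> must be positive,
    since only positive multiples of \<open>r\<close> need stay in the cone.\<close>
  define \<sigma> where "\<sigma> = (if \<alpha> > 0 then 1 else - 1 :: int)"
  show ?thesis
  proof (rule that[of "1 / \<bar>\<alpha>\<bar>" "\<lambda>j. \<sigma> * c j"])
    show "r j = 1 / \<bar>\<alpha>\<bar> * real_of_int (\<sigma> * c j)" if "j < d" for j
      using \<alpha> that \<open>\<alpha> \<noteq> 0\<close> by (auto simp: \<sigma>_def)
    show "\<bar>\<sigma> * c j\<bar> \<le> M" if "j < d" for j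
      using cM[OF that] by (simp add: \<sigma>_def abs_mult)
  qed (use \<open>\<alpha> \<noteq> 0\<close> in simp)
qed

end

subsection \<open>Determinants with few rows that are not unimodular\<close>

text \<open>At most one entry 1 and at most one entry -1. Unlike being a difference constraint, this
  survives the deletion of columns, and it also covers unit rows.\<close>

definition unimodular_row :: "('c \<Rightarrow> int) \<Rightarrow> bool" where
  "unimodular_row g \<longleftrightarrow> (\<forall>c. g c \<in> {- 1, 0, 1}) \<and>
     (\<forall>c c'. g c \<noteq> 0 \<and> g c = g c' \<longrightarrow> c = c')"

text \<open>\<open>insert_index i\<close> enumerates the indices other than \<open>i\<close>, so
  this describes the row or column selection of a minor. The second part shows that the minor loses
  the row \<open>\<rho> i\<close>, which lowers the count of sparse rows.\<close>

lemma inj_on_insert_index: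
  assumes "inj_on \<rho> {..<n}" "i < n"
  shows "inj_on (\<lambda>x. \<rho> (insert_index i x)) {..<n - 1}"
    and "(\<lambda>x. \<rho> (insert_index i x)) ` {..<n - 1} \<subseteq> \<rho> ` {..<n} - {\<rho> i}"
proof -
  have *: "insert_index i x < n \<and> insert_index i x \<noteq> i" if "x < n - 1" for x
    using that assms(2) by (auto simp: insert_index_def)
  have inj: "x = y" if "insert_index i x = insert_index i y" for x y
    using that delete_insert_index by metis
  show "inj_on (\<lambda>x. \<rho> (insert_index i x)) {..<n - 1}"
  proof (rule inj_onI)
    fix x y
    assume "x \<in> {..<n - 1}" "y \<in> {..<n - 1}" "\<rho> (insert_index i x) = \<rho> (insert_index i y)"
    then show "x = y" using assms(1) * inj by (meson inj_onD lessThan_iff)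
  qed
  show "(\<lambda>x. \<rho> (insert_index i x)) ` {..<n - 1} \<subseteq> \<rho> ` {..<n} - {\<rho> i}"
  proof
    fix y assume "y \<in> (\<lambda>x. \<rho> (insert_index i x)) ` {..<n - 1}"
    then obtain x where x: "x < n - 1" "y = \<rho> (insert_index i x)" by blast
    then have "y \<noteq> \<rho> i" using assms * by (meson inj_onD lessThan_iff)
    then show "y \<in> \<rho> ` {..<n} - {\<rho> i}" using x * by blast
  qed
qed

lemma mat_delete_mat:
  "i < n \<Longrightarrow> j < n \<Longrightarrow> mat_delete (mat n n (\<lambda>(x,y). f x y)) i j =
    mat (n - 1) (n - 1) (\<lambda>(x,y). f (insert_index i x) (insert_index j y))"
  by (intro eq_matI) (auto simp: mat_delete_def insert_index_def)

lemma abs_cofactor: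
  "\<bar>cofactor A i j\<bar> = \<bar>det (mat_delete A i j)\<bar>" for A :: "int mat"
  by (simp add: cofactor_def abs_mult power_abs)

text \<open>Two distinct selected columns with nonzero entries must carry 1 and -1, and then no
  third nonzero entry is possible.\<close>

lemma unimodular_row_sum_or_single:
  fixes \<sigma> :: "nat \<Rightarrow> 'c"
  assumes "unimodular_row g" "inj_on \<sigma> {..<n}"
  shows "(\<Sum>j<n. g (\<sigma> j)) = 0 \<or> (\<exists>j0<n. \<forall>j<n. j \<noteq> j0 \<longrightarrow> g (\<sigma> j) = 0)"
proof (cases "\<exists>j0<n. g (\<sigma> j0) \<noteq> 0")
  case True
  then obtain j0 where j0: "j0 < n" "g (\<sigma> j0) \<noteq> 0" by blast
  show ?thesis
  proof (cases "\<exists>j1<n. j1 \<noteq> j0 \<and> g (\<sigma> j1) \<noteq> 0")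
    case True
    then obtain j1 where j1: "j1 < n" "j1 \<noteq> j0" "g (\<sigma> j1) \<noteq> 0" by blast
    have val: "g c = - 1 \<or> g c = 0 \<or> g c = 1" for c
      using assms(1) by (auto simp: unimodular_row_def)
    have ne: "g (\<sigma> j) \<noteq> g (\<sigma> j')" if "j < n" "j' < n" "j \<noteq> j'" "g (\<sigma> j) \<noteq> 0" for j j'
    proof
      assume "g (\<sigma> j) = g (\<sigma> j')"
      then have "\<sigma> j = \<sigma> j'"
        using assms(1) that(4) unfolding unimodular_row_def by blast
      then show False using assms(2) that(1-3) by (auto dest: inj_onD)
    qed
    have s: "g (\<sigma> j0) + g (\<sigma> j1) = 0"
      using val[of "\<sigma> j0"] val[of "\<sigma> j1"] j0(2) j1(3) ne[OF j0(1) j1(1) j1(2)[symmetric] j0(2)]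
      by linarith
    have "g (\<sigma> j) = 0" if j: "j < n" "j \<noteq> j0" "j \<noteq> j1" for j
    proof (rule ccontr)
      assume nz: "g (\<sigma> j) \<noteq> 0"
      show False
        using val[of "\<sigma> j"] val[of "\<sigma> j0"] val[of "\<sigma> j1"] j0(2) j1(3) s nz
          ne[OF j(1) j0(1) j(2) nz] ne[OF j(1) j1(1) j(3) nz] by linarith
    qed
    then have "(\<Sum>j\<in>{..<n} - {j0,j1}. g (\<sigma> j)) = 0" by (intro sum.neutral) auto
    moreover have "(\<Sum>j<n. g (\<sigma> j)) =
        (\<Sum>j\<in>{..<n} - {j0,j1}. g (\<sigma> j)) + (\<Sum>j\<in>{j0,j1}. g (\<sigma> j))"
      using j0 j1 by (intro sum.subset_diff) auto
    ultimately show ?thesis using s j1(2) by simp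
  qed (use j0 in blast)
next
  case False
  then show ?thesis by simp
qed

text \<open>Induction by Laplace expansion. A row in \<open>S\<close> contributes at most
  \<open>w\<close> terms with entries at most \<open>a\<close>, and its minors contain one row of
  \<open>S\<close> less. If no row is in \<open>S\<close>, the argument for total unimodularity of
  difference constraints bounds the determinant by 1. The selections \<open>\<rho>\<close> and
  \<open>\<sigma>\<close> keep all minors in the form of the statement.\<close>

lemma abs_det_le_sparse_rows:
  fixes f :: "'i \<Rightarrow> 'c \<Rightarrow> int" and a :: int and w :: nat
  assumes "finite C" "finite S"
    and aw: "1 \<le> a" "1 \<le> w"
    and "\<And>x. x \<notin> S \<Longrightarrow> unimodular_row (f x)"
    and "\<And>x c. x \<in> S \<Longrightarrow> c \<in> C \<Longrightarrow> \<bar>f x c\<bar> \<le> a"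
    and "\<And>x. x \<in> S \<Longrightarrow> card {c\<in>C. f x c \<noteq> 0} \<le> w"
  shows "inj_on \<rho> {..<n} \<Longrightarrow> inj_on \<sigma> {..<n} \<Longrightarrow> \<sigma> ` {..<n} \<subseteq> C \<Longrightarrow>
    \<bar>det (mat n n (\<lambda>(i,j). f (\<rho> i) (\<sigma> j)))\<bar> \<le> (a * int w) ^ card (\<rho> ` {..<n} \<inter> S)"
proof (induction n arbitrary: \<rho> \<sigma>)
  case 0
  then show ?case by (simp add: det_def)
next
  case (Suc n)
  let ?A = "mat (Suc n) (Suc n) (\<lambda>(i,j). f (\<rho> i) (\<sigma> j))"
  have aw1: "1 \<le> a * int w" using aw mult_mono[of 1 a 1 "int w"] by simp
  have minor: "\<bar>cofactor ?A i j\<bar> \<le> (a * int w) ^ card (\<rho> ` {..<Suc n} \<inter> S - {\<rho> i})"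
    if "i < Suc n" "j < Suc n" for i j
  proof -
    let ?\<rho> = "\<lambda>x. \<rho> (insert_index i x)" and ?\<sigma> = "\<lambda>x. \<sigma> (insert_index j x)"
    note \<rho> = inj_on_insert_index[OF Suc.prems(1) that(1), simplified]
    note \<sigma> = inj_on_insert_index[OF Suc.prems(2) that(2), simplified]
    have "\<bar>cofactor ?A i j\<bar> = \<bar>det (mat n n (\<lambda>(x,y). f (?\<rho> x) (?\<sigma> y)))\<bar>"
      using that unfolding abs_cofactor by (subst mat_delete_mat) auto
    also have "\<dots> \<le> (a * int w) ^ card (?\<rho> ` {..<n} \<inter> S)"
      using \<rho> \<sigma> Suc.prems(3) by (intro Suc.IH) blast+
    also have "\<dots> \<le> (a * int w) ^ card (\<rho> ` {..<Suc n} \<inter> S - {\<rho> i})"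
      using \<rho>(2) aw1 assms(2) by (intro power_increasing card_mono) auto
    finally show ?thesis .
  qed
  have expand: "det ?A = (\<Sum>j<Suc n. f (\<rho> i) (\<sigma> j) * cofactor ?A i j)" if "i < Suc n" for i
    using that by (subst laplace_expansion_row[of _ "Suc n" i]) auto
  show ?case
  proof (cases "\<exists>i<Suc n. \<rho> i \<in> S")
    case True
    then obtain i where i: "i < Suc n" "\<rho> i \<in> S" by blast
    define q where "q = card (\<rho> ` {..<Suc n} \<inter> S - {\<rho> i})"
    have q: "card (\<rho> ` {..<Suc n} \<inter> S) = Suc q"
      unfolding q_def using i by (intro card.remove) auto
    define J where "J = {j. j < Suc n \<and> f (\<rho> i) (\<sigma> j) \<noteq> 0}"
    have "card J \<le> w"
    proof -
      have "card J = card (\<sigma> ` J)"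
        using Suc.prems(2) by (intro card_image[symmetric] inj_on_subset[OF Suc.prems(2)]) (auto simp: J_def)
      also have "\<dots> \<le> card {c\<in>C. f (\<rho> i) c \<noteq> 0}"
        using Suc.prems(3) assms(1) by (intro card_mono) (auto simp: J_def)
      finally show ?thesis using assms(7)[OF i(2)] by linarith
    qed
    have "\<bar>det ?A\<bar> = \<bar>\<Sum>j\<in>J. f (\<rho> i) (\<sigma> j) * cofactor ?A i j\<bar>"
      unfolding expand[OF i(1)] by (intro arg_cong[of _ _ abs] sum.mono_neutral_right) (auto simp: J_def)
    also have "\<dots> \<le> (\<Sum>j\<in>J. \<bar>f (\<rho> i) (\<sigma> j) * cofactor ?A i j\<bar>)" by (rule sum_abs)
    also have "\<dots> \<le> (\<Sum>j\<in>J. a * (a * int w) ^ q)"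
    proof (rule sum_mono)
      fix j assume "j \<in> J"
      then show "\<bar>f (\<rho> i) (\<sigma> j) * cofactor ?A i j\<bar> \<le> a * (a * int w) ^ q"
        unfolding abs_mult q_def
        using assms(6)[OF i(2), of "\<sigma> j"] minor[OF i(1), of j] Suc.prems(3) aw
        by (intro mult_mono) (auto simp: J_def)
    qed
    also have "\<dots> = int (card J) * (a * (a * int w) ^ q)" by simp
    also have "\<dots> \<le> int w * (a * (a * int w) ^ q)"
      using \<open>card J \<le> w\<close> aw by (intro mult_right_mono) auto
    also have "\<dots> = (a * int w) ^ Suc q" by simp
    finally show ?thesis unfolding q .
  next
    case False
    then have S0: "\<rho> ` {..<Suc n} \<inter> S = {}" by auto
    show ?thesis
    proof (cases "\<exists>i<Suc n. \<exists>j0<Suc n. \<forall>j<Suc n. j \<noteq> j0 \<longrightarrow> f (\<rho> i) (\<sigma> j) = 0")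
      case True
      then obtain i j0 where ij: "i < Suc n" "j0 < Suc n"
        "\<And>j. j < Suc n \<Longrightarrow> j \<noteq> j0 \<Longrightarrow> f (\<rho> i) (\<sigma> j) = 0" by blast
      have "(\<Sum>j<Suc n. f (\<rho> i) (\<sigma> j) * cofactor ?A i j) =
          f (\<rho> i) (\<sigma> j0) * cofactor ?A i j0"
        using ij sum.mono_neutral_right[of "{..<Suc n}" "{j0}" "\<lambda>j. f (\<rho> i) (\<sigma> j) * cofactor ?A i j"]
        by auto
      then have "\<bar>det ?A\<bar> = \<bar>f (\<rho> i) (\<sigma> j0)\<bar> * \<bar>cofactor ?A i j0\<bar>"
        unfolding expand[OF ij(1)] by (simp only: abs_mult)
      also have "\<dots> \<le> 1 * 1"
      proof (intro mult_mono)
        have "unimodular_row (f (\<rho> i))" using False ij(1) assms(5) by blast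
        then have "f (\<rho> i) (\<sigma> j0) \<in> {- 1, 0, 1}" unfolding unimodular_row_def by blast
        then show "\<bar>f (\<rho> i) (\<sigma> j0)\<bar> \<le> 1" by auto
        show "\<bar>cofactor ?A i j0\<bar> \<le> 1" using minor[OF ij(1,2)] S0 by simp
      qed auto
      finally show ?thesis using S0 by simp
    next
      case none: False
      \<comment> \<open>Now every row has an entry 1 and an entry -1 among the selected columns, so
        the all-ones vector lies in the kernel.\<close>
      have z: "(\<Sum>j<Suc n. f (\<rho> i) (\<sigma> j)) = 0" if "i < Suc n" for i
        using unimodular_row_sum_or_single[of "f (\<rho> i)" \<sigma> "Suc n"] Suc.prems(2) False none assms(5) that
        by blast
      have "?A *\<^sub>v vec (Suc n) (\<lambda>_. 1) = 0\<^sub>v (Suc n)"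
        by (rule eq_vecI) (use z in \<open>auto simp: scalar_prod_def lessThan_atLeast0\<close>)
      moreover have "vec (Suc n) (\<lambda>_. 1) \<noteq> (0\<^sub>v (Suc n) :: int vec)"
        by (metis index_vec index_zero_vec(1) zero_less_Suc zero_neq_one)
      ultimately have "det ?A = 0"
        using det_0_iff_vec_prod_zero[of ?A "Suc n"] by (metis mat_carrier vec_carrier)
      then show ?thesis using aw1 by simp
    qed
  qed
qed

subsection \<open>Rounding in the homogenised cone\<close>

text \<open>The positive factors between the extreme rays and their integral multiples are absorbed
  into the coefficients; independence of the rays bounds their number by the dimension.\<close>

lemma (in pointed_cone) integral_decomposition:
  assumes "u \<in> cone"
    and M: "\<And>\<rho> c. inj_on \<rho> {..<d - 1} \<Longrightarrow> \<rho> ` {..<d - 1} \<subseteq> I \<Longrightarrow> c < d \<Longrightarrow>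
      \<bar>det (mat (d - 1) (d - 1) (\<lambda>(i,l). G (\<rho> i) (insert_index c l)))\<bar> \<le> M"
  shows "\<exists>p\<le>d. \<exists>\<beta> c. (\<forall>j<d. u j = (\<Sum>l<p. \<beta> l * real_of_int (c l j))) \<and>
    (\<forall>l<p. 0 \<le> \<beta> l \<and> (\<lambda>j. real_of_int (c l j)) \<in> cone \<and> (\<forall>j<d. \<bar>c l j\<bar> \<le> M))"
proof -
  obtain p :: nat and r \<beta> where *: "\<forall>l<p. extremal (r l) \<and> tight u \<subseteq> tight (r l) \<and> 0 \<le> \<beta> l"
    "\<forall>j<d. u j = (\<Sum>l<p. \<beta> l * r l j)"
    "\<forall>\<alpha>. (\<forall>j<d. (\<Sum>l<p. \<alpha> l * r l j) = 0) \<longrightarrow> (\<forall>l<p. \<alpha> l = 0)"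
    using extremal_decomposition[OF assms(1)] by (elim exE conjE) (rule that, assumption+)
  have "card {..<p} \<le> d"
  proof (rule card_le_dim_of_independent[of _ _ r])
    fix \<alpha> assume "\<And>j. j < d \<Longrightarrow> (\<Sum>i<p. \<alpha> i * r i j) = 0"
    then show "\<forall>i\<in>{..<p}. \<alpha> i = 0" using *(3) by blast
  qed simp
  then have p: "p \<le> d" by simp
  have "\<exists>q. snd q > 0 \<and> (\<forall>j<d. r l j = snd q * real_of_int (fst q j)) \<and> (\<forall>j<d. \<bar>fst q j\<bar> \<le> M)"
    if "l < p" for l
  proof -
    have "extremal (r l)" using * that by blast
    from this M show ?thesis
    proof (rule extremal_integral)
      fix c \<mu> assume "\<mu> > 0" "\<And>j. j < d \<Longrightarrow> r l j = \<mu> * real_of_int (c j)"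
        "\<And>j. j < d \<Longrightarrow> \<bar>c j\<bar> \<le> M"
      then show ?thesis by (intro exI[of _ "(c, \<mu>)"]) simp
    qed
  qed
  then have "\<exists>q. \<forall>l<p. snd (q l) > 0 \<and> (\<forall>j<d. r l j = snd (q l) * real_of_int (fst (q l) j)) \<and>
      (\<forall>j<d. \<bar>fst (q l) j\<bar> \<le> M)"
    by (intro choice) blast
  then obtain q where q: "\<And>l. l < p \<Longrightarrow> snd (q l) > 0"
    "\<And>l j. l < p \<Longrightarrow> j < d \<Longrightarrow> r l j = snd (q l) * real_of_int (fst (q l) j)"
    "\<And>l j. l < p \<Longrightarrow> j < d \<Longrightarrow> \<bar>fst (q l) j\<bar> \<le> M"
    by blast
  show ?thesis
  proof (intro exI[of _ p] exI[of _ "\<lambda>l. \<beta> l * snd (q l)"] exI[of _ "\<lambda>l. fst (q l)"] conjI allI impI)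
    show "u j = (\<Sum>l<p. \<beta> l * snd (q l) * real_of_int (fst (q l) j))" if "j < d" for j
      using *(2) q(2) that by (simp add: mult.assoc)
    show "0 \<le> \<beta> l * snd (q l)" if "l < p" for l
      using * q(1)[OF that] that by simp
    show "(\<lambda>j. real_of_int (fst (q l) j)) \<in> cone" if l: "l < p" for l
    proof -
      have "ev i (r l) = snd (q l) * ev i (\<lambda>j. real_of_int (fst (q l) j))" for i
        unfolding ev_scale[symmetric] by (rule ev_cong) (use q(2) l in simp)
      moreover have "r l \<in> cone" using * l by (simp add: extremal_def)
      ultimately show ?thesis using q(1)[OF l] by (simp add: cone_def zero_le_mult_iff)
    qed
  qed (use p q(3) in auto)
qed

text \<open>\<open>Inl i\<close> is the row \<open>a\<^sub>i x - b\<^sub>i t \<ge> 0\<close>, \<open>Inr l\<close> the sign constraint on the \<open>l\<close>-th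
  variable; the homogenising variable \<open>t\<close> has index \<open>N\<close>.\<close>

fun hom_row :: "nat \<Rightarrow> (nat \<Rightarrow> nat \<Rightarrow> int) \<Rightarrow> (nat \<Rightarrow> int) \<Rightarrow> nat + nat \<Rightarrow> nat \<Rightarrow> int" where
  "hom_row N a b (Inl i) j = (if j < N then a i j else if j = N then - b i else 0)"
| "hom_row N a b (Inr l) j = (if j = l then 1 else 0)"

definition hom_index :: "nat \<Rightarrow> nat \<Rightarrow> (nat + nat) set" where
  "hom_index m N = Inl ` {..<m} \<union> Inr ` {..N}"

lemma bounded_integer_point:
  fixes a :: "nat \<Rightarrow> nat \<Rightarrow> int"
  assumes sol: "\<And>i. i < m \<Longrightarrow> b i \<le> (\<Sum>j<N. a i j * z j)" "\<And>j. j < N \<Longrightarrow> 0 \<le> z j"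
    and M: "\<And>\<rho> c. inj_on \<rho> {..<N} \<Longrightarrow> \<rho> ` {..<N} \<subseteq> hom_index m N \<Longrightarrow> c \<le> N \<Longrightarrow>
      \<bar>det (mat N N (\<lambda>(i,l). hom_row N a b (\<rho> i) (insert_index c l)))\<bar> \<le> M"
  obtains x where "\<And>i. i < m \<Longrightarrow> b i \<le> (\<Sum>j<N. a i j * x j)"
    "\<And>j. j < N \<Longrightarrow> 0 \<le> x j" "\<And>j. j < N \<Longrightarrow> x j \<le> int (N + 1) * M"
proof -
  let ?G = "hom_row N a b"
  have unit: "(\<Sum>j<Suc N. real_of_int (?G (Inr l) j) * v j) = v l" if "l \<le> N" for l v
  proof -
    have "(\<Sum>j<Suc N. real_of_int (?G (Inr l) j) * v j) = (\<Sum>j<Suc N. if j = l then v j else 0)"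
      by (intro sum.cong) auto
    then show ?thesis using that by simp
  qed
  interpret pointed_cone "Suc N" "hom_index m N" ?G
  proof
    show "finite (hom_index m N)" by (simp add: hom_index_def)
    fix v :: "nat \<Rightarrow> real"
    assume v: "\<And>i. i \<in> hom_index m N \<Longrightarrow> (\<Sum>j<Suc N. real_of_int (?G i j) * v j) = 0"
    show "\<forall>j<Suc N. v j = 0"
    proof (intro allI impI)
      fix j assume "j < Suc N"
      then show "v j = 0" using v[of "Inr j"] unit[of j v] by (auto simp: hom_index_def)
    qed
  qed
  have ev_Inr: "ev (Inr l) v = v l" if "l \<le> N" for l v
    unfolding ev_def by (rule unit[OF that])
  have ev_Inl: "ev (Inl i) v = (\<Sum>j<N. real_of_int (a i j) * v j) - real_of_int (b i) * v N" for i v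
    unfolding ev_def by simp
  define u where "u j = (if j < N then z j else 1)" for j
  have "(\<lambda>j. real_of_int (u j)) \<in> cone"
    unfolding cone_def
  proof (intro CollectI ballI)
    fix x assume "x \<in> hom_index m N"
    then consider i where "x = Inl i" "i < m" | l where "x = Inr l" "l \<le> N"
      by (auto simp: hom_index_def)
    then show "0 \<le> ev x (\<lambda>j. real_of_int (u j))"
    proof cases
      case 1
      have "real_of_int (b i) \<le> real_of_int (\<Sum>j<N. a i j * z j)"
        using sol(1)[OF 1(2)] by (simp only: of_int_le_iff)
      then show ?thesis
        unfolding 1(1) ev_Inl by (simp add: u_def)
    next
      case 2
      then show ?thesis using sol(2) by (simp add: ev_Inr u_def)
    qed
  qed
  moreover have "\<bar>det (mat (Suc N - 1) (Suc N - 1) (\<lambda>(i,l). ?G (\<rho> i) (insert_index c l)))\<bar> \<le> M"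
    if "inj_on \<rho> {..<Suc N - 1}" "\<rho> ` {..<Suc N - 1} \<subseteq> hom_index m N" "c < Suc N" for \<rho> c
    using M[of \<rho> c] that by simp
  ultimately have "\<exists>p\<le>Suc N. \<exists>\<beta> c.
      (\<forall>j<Suc N. real_of_int (u j) = (\<Sum>l<p. \<beta> l * real_of_int (c l j))) \<and>
      (\<forall>l<p. 0 \<le> \<beta> l \<and> (\<lambda>j. real_of_int (c l j)) \<in> cone \<and> (\<forall>j<Suc N. \<bar>c l j\<bar> \<le> M))"
    by (rule integral_decomposition)
  then obtain p \<beta> c where dec: "p \<le> Suc N"
    "\<And>j. j < Suc N \<Longrightarrow> real_of_int (u j) = (\<Sum>l<p. \<beta> l * real_of_int (c l j))"
    "\<And>l. l < p \<Longrightarrow> 0 \<le> \<beta> l"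
    "\<And>l. l < p \<Longrightarrow> (\<lambda>j. real_of_int (c l j)) \<in> cone"
    "\<And>l j. l < p \<Longrightarrow> j < Suc N \<Longrightarrow> \<bar>c l j\<bar> \<le> M"
    by blast
  \<comment> \<open>Rays in \<open>J0\<close> are recession directions of the original system; those
    in \<open>J1\<close> have last coordinate at least 1, by integrality and
    \<open>cN\<close>.\<close>
  define J0 where "J0 = {l. l < p \<and> c l N = 0}"
  define J1 where "J1 = {l. l < p \<and> c l N \<noteq> 0}"
  have J: "finite J0" "finite J1" "J0 \<inter> J1 = {}" "{..<p} = J0 \<union> J1"
    by (auto simp: J0_def J1_def)
  have cN: "0 \<le> c l N" if "l < p" for l
  proof -
    have "0 \<le> ev (Inr N) (\<lambda>j. real_of_int (c l j))"
      using dec(4)[OF that] unfolding cone_def by (auto simp: hom_index_def)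
    then show ?thesis by (simp add: ev_Inr)
  qed
  \<comment> \<open>The coefficients left after subtracting integer parts on \<open>J0\<close> only.
    This keeps the point integral, in the cone and at height 1.\<close>
  define \<gamma> where "\<gamma> l = (if l \<in> J0 then frac (\<beta> l) else \<beta> l)" for l
  have \<gamma>0: "0 \<le> \<gamma> l" if "l < p" for l
    using dec(3)[OF that] by (simp add: \<gamma>_def)
  define y where "y j = u j - (\<Sum>l\<in>J0. \<lfloor>\<beta> l\<rfloor> * c l j)" for j
  have y: "real_of_int (y j) = (\<Sum>l<p. \<gamma> l * real_of_int (c l j))" if "j < Suc N" for j
  proof -
    have "real_of_int (y j) = (\<Sum>l<p. \<beta> l * real_of_int (c l j))
        - (\<Sum>l\<in>J0. real_of_int \<lfloor>\<beta> l\<rfloor> * real_of_int (c l j))"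
      using dec(2)[OF that] by (simp add: y_def)
    also have "\<dots> = (\<Sum>l\<in>J0. \<beta> l * real_of_int (c l j) - real_of_int \<lfloor>\<beta> l\<rfloor> * real_of_int (c l j))
        + (\<Sum>l\<in>J1. \<beta> l * real_of_int (c l j))"
      unfolding J(4) sum.union_disjoint[OF J(1-3)] by (simp add: sum_subtractf)
    also have "\<dots> = (\<Sum>l\<in>J0. \<gamma> l * real_of_int (c l j)) + (\<Sum>l\<in>J1. \<gamma> l * real_of_int (c l j))"
      using J(3) by (intro arg_cong2[of _ _ _ _ "(+)"] sum.cong)
        (auto simp: \<gamma>_def frac_def algebra_simps)
    finally show ?thesis unfolding J(4) sum.union_disjoint[OF J(1-3)] .
  qed
  have yN: "y N = 1" by (simp add: y_def u_def J0_def)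
  have pos: "0 \<le> ev i (\<lambda>j. real_of_int (y j))" if "i \<in> hom_index m N" for i
  proof -
    have "ev i (\<lambda>j. real_of_int (y j)) = (\<Sum>l<p. \<gamma> l * ev i (\<lambda>j. real_of_int (c l j)))"
      unfolding ev_sum[symmetric] by (rule ev_cong) (rule y)
    also have "\<dots> \<ge> 0"
      using \<gamma>0 dec(4) that by (intro sum_nonneg mult_nonneg_nonneg) (auto simp: cone_def)
    finally show ?thesis .
  qed
  have sumJ1: "(\<Sum>l\<in>J1. \<gamma> l) \<le> 1"
  proof -
    have "(\<Sum>l\<in>J1. \<gamma> l) \<le> (\<Sum>l\<in>J1. \<gamma> l * real_of_int (c l N))"
    proof (rule sum_mono)
      fix l assume "l \<in> J1"
      then have "l < p" "1 \<le> c l N" using cN[of l] by (auto simp: J1_def)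
      then show "\<gamma> l \<le> \<gamma> l * real_of_int (c l N)"
        using mult_left_mono[of 1 "real_of_int (c l N)" "\<gamma> l"] \<gamma>0 by simp
    qed
    also have "\<dots> = (\<Sum>l<p. \<gamma> l * real_of_int (c l N))"
      by (intro sum.mono_neutral_left) (auto simp: J1_def)
    also have "\<dots> = 1" using y[of N] yN by simp
    finally show ?thesis .
  qed
  \<comment> \<open>Height 1 cannot be reached with rays of height 0. So at most \<open>N\<close> of
    the at most \<open>N + 1\<close> rays lie in \<open>J0\<close>, which makes the factor
    \<open>N + 1\<close> instead of \<open>N + 2\<close>.\<close>
  have "J1 \<noteq> {}"
  proof
    assume "J1 = {}"
    then have "(\<Sum>l<p. \<gamma> l * real_of_int (c l N)) = 0"
      by (intro sum.neutral) (auto simp: J1_def)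
    then show False using y[of N] yN by simp
  qed
  then obtain l1 where l1: "l1 < p" "l1 \<in> J1" by (auto simp: J1_def)
  have M0: "0 \<le> M" using dec(5)[OF l1(1), of N] by simp
  have "card J0 \<le> N"
  proof -
    have "J0 \<subseteq> {..<p} - {l1}" using l1 J by auto
    then have "card J0 \<le> card ({..<p} - {l1})" by (intro card_mono) auto
    then show ?thesis using l1(1) dec(1) by simp
  qed
  moreover have "(\<Sum>l\<in>J0. \<gamma> l) \<le> (\<Sum>l\<in>J0. 1)"
    by (rule sum_mono) (simp add: \<gamma>_def frac_lt_1 less_imp_le)
  ultimately have sum\<gamma>: "(\<Sum>l<p. \<gamma> l) \<le> real (N + 1)"
    unfolding J(4) sum.union_disjoint[OF J(1-3)] using sumJ1 by simp
  have bound: "y j \<le> int (N + 1) * M" if "j < N" for j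
  proof -
    have "real_of_int (y j) = (\<Sum>l<p. \<gamma> l * real_of_int (c l j))" using y that by simp
    also have "\<dots> \<le> (\<Sum>l<p. \<gamma> l * real_of_int M)"
    proof (intro sum_mono mult_left_mono)
      fix l assume "l \<in> {..<p}"
      then show "real_of_int (c l j) \<le> real_of_int M" "0 \<le> \<gamma> l"
        using dec(5)[of l j] \<gamma>0 that by auto
    qed
    also have "\<dots> = (\<Sum>l<p. \<gamma> l) * real_of_int M" by (simp add: sum_distrib_right)
    also have "\<dots> \<le> real (N + 1) * real_of_int M"
      using sum\<gamma> M0 by (intro mult_right_mono) auto
    also have "\<dots> = real_of_int (int (N + 1) * M)" by simp
    finally show ?thesis by linarith
  qed
  show ?thesis
  proof (rule that[of y])
    show "b i \<le> (\<Sum>j<N. a i j * y j)" if "i < m" for i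
    proof -
      have "real_of_int (b i) \<le> (\<Sum>j<N. real_of_int (a i j) * real_of_int (y j))"
        using pos[of "Inl i"] that yN by (simp add: ev_Inl hom_index_def)
      also have "\<dots> = real_of_int (\<Sum>j<N. a i j * y j)" by simp
      finally show ?thesis by linarith
    qed
    show "0 \<le> y j" if "j < N" for j
      using pos[of "Inr j"] that by (simp add: ev_Inr hom_index_def)
  qed (rule bound)
qed

subsection \<open>Minors of the homogenised system\<close>

text \<open>\<open>\<alpha>\<close> and \<open>\<beta>\<close> stand for the maximal absolute values
  of the coefficients and of the right-hand side, \<open>S\<close> for the rows that need not be
  difference constraints. The lower bounds 1 hold as soon as the right-hand side has a positive
  entry and the system is solvable.\<close>

locale sparse_system =
  fixes m N k w :: nat and a :: "nat \<Rightarrow> nat \<Rightarrow> int" and b :: "nat \<Rightarrow> int"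
    and S :: "nat set" and \<alpha> \<beta> :: int
  assumes finite_S: "finite S" and card_S: "card S \<le> k"
    and \<alpha>: "1 \<le> \<alpha>" and w: "1 \<le> w"
    and unimodular: "\<And>i. i < m \<Longrightarrow> i \<notin> S \<Longrightarrow> unimodular_row (\<lambda>j. if j < N then a i j else 0)"
    and entries: "\<And>i j. i < m \<Longrightarrow> j < N \<Longrightarrow> \<bar>a i j\<bar> \<le> \<alpha>"
    and sparse: "\<And>i. i < m \<Longrightarrow> i \<in> S \<Longrightarrow> card {j\<in>{..<N}. a i j \<noteq> 0} \<le> w"
    and \<beta>: "1 \<le> \<beta>" "\<And>i. i < m \<Longrightarrow> \<bar>b i\<bar> \<le> \<beta>"
    and nonempty: "0 < m" "0 < N"
begin

lemma one_le_minor_bound: "1 \<le> \<alpha> * int w"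
  using \<alpha> w mult_mono[of 1 \<alpha> 1 "int w"] by simp

lemma abs_minor_coefficient_columns:
  assumes "inj_on \<rho> {..<r}" "\<rho> ` {..<r} \<subseteq> hom_index m N" "inj_on \<sigma> {..<r}" "\<sigma> ` {..<r} \<subseteq> {..<N}"
  shows "\<bar>det (mat r r (\<lambda>(x,y). hom_row N a b (\<rho> x) (\<sigma> y)))\<bar> \<le> (\<alpha> * int w) ^ k"
proof -
  \<comment> \<open>Entries outside the system are set to 0, so that every row outside
    \<open>S\<close>, even at a meaningless index, is unimodular.\<close>
  define f where "f x j = (if x \<in> hom_index m N \<and> j < N then hom_row N a b x j else 0)" for x j
  have "mat r r (\<lambda>(x,y). hom_row N a b (\<rho> x) (\<sigma> y)) = mat r r (\<lambda>(x,y). f (\<rho> x) (\<sigma> y))"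
    using assms(2,4) by (intro eq_matI) (auto simp: f_def image_subset_iff)
  also have "\<bar>det \<dots>\<bar> \<le> (\<alpha> * int w) ^ card (\<rho> ` {..<r} \<inter> Inl ` (S \<inter> {..<m}))"
  proof (rule abs_det_le_sparse_rows[of "{..<N}"])
    fix x :: "nat + nat" assume x: "x \<notin> Inl ` (S \<inter> {..<m})"
    consider i where "x = Inl i" "i < m" "i \<notin> S" | l where "x = Inr l"
      | i where "x = Inl i" "\<not> i < m"
      using x by (cases x) auto
    then show "unimodular_row (f x)"
    proof cases
      case 1
      then have "f x = (\<lambda>j. if j < N then a i j else 0)" by (auto simp: f_def hom_index_def)
      then show ?thesis using unimodular 1 by simp
    qed (auto simp: f_def hom_index_def unimodular_row_def split: if_splits)
  next
    fix x :: "nat + nat" and c assume "x \<in> Inl ` (S \<inter> {..<m})" "c \<in> {..<N}"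
    then show "\<bar>f x c\<bar> \<le> \<alpha>" using entries by (auto simp: f_def hom_index_def)
  next
    fix x :: "nat + nat" assume "x \<in> Inl ` (S \<inter> {..<m})"
    then obtain i where i: "x = Inl i" "i \<in> S" "i < m" by auto
    then have "{c \<in> {..<N}. f x c \<noteq> 0} = {c \<in> {..<N}. a i c \<noteq> 0}"
      by (auto simp: f_def hom_index_def)
    then show "card {c \<in> {..<N}. f x c \<noteq> 0} \<le> w" using sparse i by simp
  qed (use assms finite_S \<alpha> w in auto)
  also have "\<dots> \<le> (\<alpha> * int w) ^ k"
  proof (rule power_increasing[OF _ one_le_minor_bound])
    have "card (\<rho> ` {..<r} \<inter> Inl ` (S \<inter> {..<m})) \<le> card (Inl ` (S \<inter> {..<m}) :: (nat + nat) set)"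
      using finite_S by (intro card_mono) auto
    also have "\<dots> = card (S \<inter> {..<m})" by (simp add: card_image)
    also have "\<dots> \<le> card S" using finite_S by (intro card_mono) auto
    finally show "card (\<rho> ` {..<r} \<inter> Inl ` (S \<inter> {..<m})) \<le> k" using card_S by linarith
  qed
  finally show ?thesis .
qed

text \<open>If the column of the homogenising variable is deleted, only coefficient columns remain.
  Otherwise it is the last column of the minor, and expansion along it leaves cofactors with
  coefficient columns only.\<close>

lemma abs_minor:
  assumes \<rho>: "inj_on \<rho> {..<N}" "\<rho> ` {..<N} \<subseteq> hom_index m N" and "c \<le> N"
  shows "\<bar>det (mat N N (\<lambda>(x,y). hom_row N a b (\<rho> x) (insert_index c y)))\<bar>
    \<le> int (min N m) * \<beta> * (\<alpha> * int w) ^ k"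
proof -
  let ?K = "(\<alpha> * int w) ^ k" and ?B = "mat N N (\<lambda>(x,y). hom_row N a b (\<rho> x) (insert_index c y))"
  have K: "1 \<le> ?K" using one_le_minor_bound by (rule one_le_power)
  have "1 * 1 \<le> int (min N m) * \<beta>"
    using nonempty \<beta>(1) by (intro mult_mono) auto
  then have K_le: "?K \<le> int (min N m) * \<beta> * ?K"
    using mult_right_mono[of 1 "int (min N m) * \<beta>" ?K] K by simp
  show ?thesis
  proof (cases "c = N")
    case True
    then have "inj_on (insert_index c) {..<N}" "insert_index c ` {..<N} \<subseteq> {..<N}"
      by (auto simp: inj_on_def)
    then show ?thesis
      using abs_minor_coefficient_columns[OF \<rho>, of "insert_index c"] K_le by linarith
  next
    case False
    then have c: "c < N" using assms(3) by simp
    have cof: "\<bar>cofactor ?B i (N - 1)\<bar> \<le> ?K" if i: "i < N" for i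
    proof -
      note \<rho>i = inj_on_insert_index[OF \<rho>(1) i]
      have "\<bar>cofactor ?B i (N - 1)\<bar> = \<bar>det (mat (N - 1) (N - 1)
          (\<lambda>(x,y). hom_row N a b (\<rho> (insert_index i x)) (insert_index c y)))\<bar>"
        unfolding abs_cofactor using i
        by (subst mat_delete_mat) (auto intro!: arg_cong[of _ _ "\<lambda>B. \<bar>det B\<bar>"] eq_matI)
      also have "\<dots> \<le> ?K"
      proof (rule abs_minor_coefficient_columns)
        show "inj_on (insert_index c) {..<N - 1}"
          by (rule inj_onI) (metis delete_insert_index)
        show "insert_index c ` {..<N - 1} \<subseteq> {..<N}"
          by (auto simp: insert_index_def)
      qed (use \<rho>i \<rho>(2) in blast)+
      finally show ?thesis .
    qed
    have last: "insert_index c (N - 1) = N" using c by simp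
    show ?thesis
    \<comment> \<open>The row \<open>Inr N\<close> would add an entry of its own to the last column.
      If it is selected, its single nonzero entry 1 reduces the minor to one cofactor.\<close>
    proof (cases "Inr N \<in> \<rho> ` {..<N}")
      case True
      then obtain i where i: "i < N" "\<rho> i = Inr N" by auto
      have "det ?B = (\<Sum>y<N. ?B $$ (i,y) * cofactor ?B i y)"
        using i by (intro laplace_expansion_row) auto
      also have "\<dots> = (\<Sum>y\<in>{N - 1}. ?B $$ (i,y) * cofactor ?B i y)"
        using i by (intro sum.mono_neutral_right) (auto simp: insert_index_def split: if_splits)
      also have "\<dots> = cofactor ?B i (N - 1)" using i last by simp
      finally show ?thesis using cof[OF i(1)] K_le by simp
    next
      case False
      \<comment> \<open>Only the rows \<open>Inl i\<close> can now be nonzero in the last column.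
        There are at most \<open>N\<close> of them by the order of the minor, and at most
        \<open>m\<close> by injectivity of \<open>\<rho>\<close>.\<close>
      define T where "T = {x. x < N \<and> \<rho> x \<in> Inl ` {..<m}}"
      have "card T \<le> N" using card_mono[of "{..<N}" T] by (auto simp: T_def)
      moreover have "card T \<le> m"
      proof -
        have "card T = card (\<rho> ` T)"
          by (intro card_image[symmetric] inj_on_subset[OF \<rho>(1)]) (auto simp: T_def)
        also have "\<dots> \<le> card (Inl ` {..<m} :: (nat + nat) set)"
          by (intro card_mono) (auto simp: T_def)
        finally show ?thesis by (simp add: card_image)
      qed
      ultimately have T: "card T \<le> min N m" by simp
      have "det ?B = (\<Sum>x<N. ?B $$ (x,N - 1) * cofactor ?B x (N - 1))"
        using nonempty by (intro laplace_expansion_column) auto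
      also have "\<dots> = (\<Sum>x\<in>T. ?B $$ (x,N - 1) * cofactor ?B x (N - 1))"
      proof (intro sum.mono_neutral_right ballI)
        fix x assume x: "x \<in> {..<N} - T"
        then obtain l where "\<rho> x = Inr l" using \<rho>(2) by (auto simp: T_def hom_index_def)
        moreover from this have "l \<noteq> N" using False x by force
        ultimately show "?B $$ (x,N - 1) * cofactor ?B x (N - 1) = 0"
          using x last by simp
      qed (auto simp: T_def)
      finally have "\<bar>det ?B\<bar> \<le> (\<Sum>x\<in>T. \<bar>?B $$ (x,N - 1) * cofactor ?B x (N - 1)\<bar>)"
        by (simp only: sum_abs)
      also have "\<dots> \<le> (\<Sum>x\<in>T. \<beta> * ?K)"
      proof (rule sum_mono)
        fix x assume "x \<in> T"
        then obtain i where i: "x < N" "i < m" "\<rho> x = Inl i" by (auto simp: T_def)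
        then have "\<bar>?B $$ (x,N - 1)\<bar> \<le> \<beta>" using \<beta>(2)[OF i(2)] last by simp
        then show "\<bar>?B $$ (x,N - 1) * cofactor ?B x (N - 1)\<bar> \<le> \<beta> * ?K"
          unfolding abs_mult using cof[OF i(1)] \<beta>(1) by (intro mult_mono) auto
      qed
      also have "\<dots> = int (card T) * (\<beta> * ?K)" by simp
      also have "\<dots> \<le> int (min N m) * (\<beta> * ?K)"
        using T \<beta>(1) K by (intro mult_right_mono) auto
      finally show ?thesis by (simp only: mult.assoc)
    qed
  qed
qed

end

section \<open>Transfer to matrices and the solution bound\<close>

lemma unimodular_row_difference_constraint:
  assumes "difference_constraint (row B i)" "i < dim_row B"
  shows "unimodular_row (\<lambda>j. if j < dim_col B then B $$ (i,j) else 0)"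
proof -
  obtain p q where pq: "p < dim_col B" "q < dim_col B" "p \<noteq> q" "B $$ (i,p) = 1" "B $$ (i,q) = - 1"
    "\<And>j. j < dim_col B \<Longrightarrow> j \<noteq> p \<Longrightarrow> j \<noteq> q \<Longrightarrow> B $$ (i,j) = 0"
    using assms by (auto simp: difference_constraint_def)
  have "(\<lambda>j. if j < dim_col B then B $$ (i,j) else 0) =
    (\<lambda>j. if j = p then 1 else if j = q then - 1 else 0)"
    using pq by auto
  moreover have "unimodular_row (\<lambda>j. if j = p then 1 else if j = q then - 1 else 0)"
    by (auto simp: unimodular_row_def)
  ultimately show ?thesis by simp
qed

lemma mem_nonneg_solutions_iff:
  "x \<in> nonneg_solutions B b \<longleftrightarrow> x \<in> carrier_vec (dim_col B) \<and> dim_vec b = dim_row B \<and>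
    (\<forall>i<dim_row B. b $ i \<le> (\<Sum>j<dim_col B. B $$ (i,j) * x $ j)) \<and> (\<forall>j<dim_col B. 0 \<le> x $ j)"
  by (auto simp: nonneg_solutions_def less_eq_vec_def scalar_prod_def lessThan_atLeast0)

lemma abs_le_max_abs_mat:
  assumes "i < dim_row B" "j < dim_col B"
  shows "\<bar>B $$ (i,j)\<bar> \<le> max_abs_mat B"
  unfolding max_abs_mat_def
proof (rule Max_ge)
  show "finite (abs ` elements_mat B)" by (simp add: elements_mat_def)
  show "\<bar>B $$ (i,j)\<bar> \<in> abs ` elements_mat B" using assms by (intro imageI elements_matI) auto
qed

lemma abs_le_max_abs_vec:
  assumes "i < dim_vec v"
  shows "\<bar>v $ i\<bar> \<le> max_abs_vec v"
  unfolding max_abs_vec_def using assms by (intro Max_ge) (auto simp: vec_set_def)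

theorem theorem5:
  fixes A :: "int mat" and b :: "int vec" and m n k w :: nat and D :: "nat set"
  assumes "A \<in> carrier_mat m n"
    and "b \<in> carrier_vec m"
    and "D \<subseteq> {0..<m}" and "k \<le> m" and "card D = m - k"
    and "\<And>i. i \<in> D \<Longrightarrow> difference_constraint (row (ext_mat A) i)"
    and "k \<le> n + 1"
    and "w \<ge> 1"
    and "\<And>i. i \<in> {0..<m} - D \<Longrightarrow> num_nonzero (row (ext_mat A) i) \<le> w"
  shows "solution_bound (nonneg_solutions (ext_mat A) b)
    (int (n + 2) * int (min (n + 1) m) * max_abs_vec b * (max_abs_mat (ext_mat A) * int w) ^ k)"
    (is "solution_bound ?X ?d")
proof -
  let ?B = "ext_mat A"
  have dim: "dim_row ?B = m" "dim_col ?B = n + 1" "dim_vec b = m"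
    using assms(1,2) by (auto simp: ext_mat_def)
  have "\<exists>x. x \<in> ?X \<and> (\<forall>j<dim_vec x. x $ j \<in> {0..?d})" if "z \<in> ?X" for z
  \<comment> \<open>Without a positive right-hand side the zero vector is a solution, and only
    \<open>0 \<le> ?d\<close> is to be checked. For \<open>m = 0\<close> the maxima are unspecified,
    but the factor \<open>min (n + 1) m\<close> is 0.\<close>
  proof (cases "\<exists>i<m. 0 < b $ i")
    case False
    have "0 \<le> ?d"
    proof (cases "m = 0")
      case False
      then have "0 \<le> max_abs_vec b" using abs_le_max_abs_vec[of 0 b] dim by simp
      moreover have "0 \<le> max_abs_mat ?B" using abs_le_max_abs_mat[of 0 ?B 0] dim False by simp
      ultimately show ?thesis by simp
    qed simp
    moreover have "0\<^sub>v (n + 1) \<in> ?X"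
    proof -
      have "b $ i \<le> 0" if "i < m" for i using False that by (meson not_le)
      then show ?thesis using dim by (auto simp: mem_nonneg_solutions_iff)
    qed
    ultimately show ?thesis by (intro exI[of _ "0\<^sub>v (n + 1)"]) auto
  next
    case True
    then obtain i0 where i0: "i0 < m" "0 < b $ i0" by blast
    have z: "b $ i \<le> (\<Sum>j<n + 1. ?B $$ (i,j) * z $ j)" if "i < m" for i
      using \<open>z \<in> ?X\<close> that by (simp add: mem_nonneg_solutions_iff dim)
    have z0: "0 \<le> z $ j" if "j < n + 1" for j
      using \<open>z \<in> ?X\<close> that by (simp add: mem_nonneg_solutions_iff dim)
    \<comment> \<open>A zero row cannot exceed a positive bound, so row \<open>i0\<close> has a
      nonzero integer entry and the maximal coefficient is at least 1.\<close>
    have "\<exists>j<n + 1. ?B $$ (i0,j) \<noteq> 0"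
    proof (rule ccontr)
      assume "\<not> ?thesis"
      then have "(\<Sum>j<n + 1. ?B $$ (i0,j) * z $ j) = 0" by (intro sum.neutral) auto
      then show False using z[OF i0(1)] i0(2) by simp
    qed
    then obtain j0 where j0: "j0 < n + 1" "?B $$ (i0,j0) \<noteq> 0" by blast
    interpret sparse_system m "n + 1" k w "\<lambda>i j. ?B $$ (i,j)" "\<lambda>i. b $ i" "{0..<m} - D"
      "max_abs_mat ?B" "max_abs_vec b"
    proof
      show "card ({0..<m} - D) \<le> k"
        using assms(3,4,5) by (simp add: card_Diff_subset finite_subset)
      show "1 \<le> max_abs_mat ?B"
        using abs_le_max_abs_mat[of i0 ?B j0] i0 j0 dim by simp
      show "1 \<le> max_abs_vec b"
        using abs_le_max_abs_vec[of i0 b] i0 dim by simp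
      show "unimodular_row (\<lambda>j. if j < n + 1 then ?B $$ (i,j) else 0)"
        if "i < m" "i \<notin> {0..<m} - D" for i
        using unimodular_row_difference_constraint[of ?B i] assms(6)[of i] that dim by simp
      show "card {j \<in> {..<n + 1}. ?B $$ (i,j) \<noteq> 0} \<le> w" if "i < m" "i \<in> {0..<m} - D" for i
      proof -
        have "{j. j < dim_vec (row ?B i) \<and> row ?B i $ j \<noteq> 0} = {j \<in> {..<n + 1}. ?B $$ (i,j) \<noteq> 0}"
          using that dim by auto
        then show ?thesis using assms(9)[OF that(2)] by (simp add: num_nonzero_def)
      qed
    qed (use assms(8) i0 abs_le_max_abs_mat[of _ ?B] abs_le_max_abs_vec[of _ b] dim in auto)
    \<comment> \<open>The system has \<open>n + 1\<close> variables, so the factor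
      \<open>N + 1\<close> becomes \<open>n + 2\<close>.\<close>
    obtain x where x: "\<And>i. i < m \<Longrightarrow> b $ i \<le> (\<Sum>j<n + 1. ?B $$ (i,j) * x j)"
      "\<And>j. j < n + 1 \<Longrightarrow> 0 \<le> x j"
      "\<And>j. j < n + 1 \<Longrightarrow> x j \<le> int (n + 1 + 1) *
        (int (min (n + 1) m) * max_abs_vec b * (max_abs_mat ?B * int w) ^ k)"
      using bounded_integer_point[OF z z0 abs_minor] by blast
    have "vec (n + 1) x \<in> ?X"
      using x(1,2) dim by (simp add: mem_nonneg_solutions_iff)
    moreover have "\<forall>j<n + 1. x j \<le> ?d"
      using x(3) by (simp add: mult.assoc)
    ultimately show ?thesis using x(2) by (intro exI[of _ "vec (n + 1) x"]) auto
  qed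
  then show ?thesis unfolding solution_bound_def by blast
qed

end
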